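(* Let $a>1$, let $X$ be a random variable with values in $\mathbb{N}_0$ and probability mass function $p_j=\mathbf{P}\{X=j\}$, $j\in\mathbb{N}_0$, and let $Y=a^X$. Suppose that there is a constant $C>0$ such that $$p_j\geqslant C\,a^{-j(j-1)/2}\quad\text{for all } j\in\mathbb{N}_0 .$$ Then there exists a perturbation of the probability mass function $p_Y$ of $Y$; and therefore the distribution of $Y$ is moment-indeterminate, provided that $Y$ has finite moments of all orders.
   Context: $\mathbb{N}_0=\{0,1,2,\dots\}$. For a discrete probability mass function $p$ given by $p(x_j)=p_j$, $j\in\mathbb{N}_0$ (with distinct real points $x_j$), a sequence of real numbers $h=\{h_j\}_{j\in\mathbb{N}_0}$ is called a perturbation for (or of) $p$ if $\sup_j|h_j|=1$ and $\sum_{j=0}^\infty x_j^k p_j h_j=0$ for all $k\in\mathbb{N}_0$. For $Y=a^X$ one takes $x_j=a^j$ and $p_Y(a^j)=p_j$, so a perturbation of $p_Y$ is a real sequence $h$ with $\sup_j|h_j|=1$ and $\sum_{j=0}^\infty a^{kj}p_jh_j=0$ for all $k\in\mathbb{N}_0$. A probability distribution with finite moments of all orders is moment-indeterminate if there is a different probability distribution on $\mathbb{R}$ having the same moments of all orders. *)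

theory Defs
  imports "HOL-Probability.Probability"
begin

text \<open>A probability mass function \<open>p\<close> on the real line, concentrated on the distinct points \<open>x j\<close>.
  Some of the masses \<open>p (x j)\<close> may vanish.\<close>

definition discrete_pmf :: "(nat \<Rightarrow> real) \<Rightarrow> (real \<Rightarrow> real) \<Rightarrow> bool" where
  "discrete_pmf x p \<longleftrightarrow>
     inj x \<and> (\<forall>y. 0 \<le> p y) \<and> (\<forall>y. y \<notin> range x \<longrightarrow> p y = 0) \<and> (\<lambda>j. p (x j)) sums 1"

text \<open>Boundedness has to be stated separately, since \<open>SUP\<close> on the reals is unspecified for
  unbounded families. The vanishing series are required to converge, and nothing is assumed about
  the moments of \<open>p\<close> itself.\<close>

definition perturbation :: "(nat \<Rightarrow> real) \<Rightarrow> (real \<Rightarrow> real) \<Rightarrow> (nat \<Rightarrow> real) \<Rightarrow> bool" where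
  "perturbation x p h \<longleftrightarrow>
     discrete_pmf x p \<and>
     bdd_above (range (\<lambda>j. \<bar>h j\<bar>)) \<and> (SUP j. \<bar>h j\<bar>) = 1 \<and>
     (\<forall>k::nat. (\<lambda>j. x j ^ k * p (x j) * h j) sums 0)"

definition prob_distribution :: "real measure \<Rightarrow> bool" where
  "prob_distribution \<mu> \<longleftrightarrow> prob_space \<mu> \<and> sets \<mu> = sets borel"

definition finite_moments :: "real measure \<Rightarrow> bool" where
  "finite_moments \<mu> \<longleftrightarrow> (\<forall>k::nat. integrable \<mu> (\<lambda>y. y ^ k))"

definition moment_indeterminate :: "real measure \<Rightarrow> bool" where
  "moment_indeterminate \<mu> \<longleftrightarrow>
     prob_distribution \<mu> \<and> finite_moments \<mu> \<and>
     (\<exists>\<nu>. prob_distribution \<nu> \<and> finite_moments \<nu> \<and> \<nu> \<noteq> \<mu> \<and>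
        (\<forall>k::nat. (\<integral>y. y ^ k \<partial>\<nu>) = (\<integral>y. y ^ k \<partial>\<mu>)))"

end

theory Submission imports Defs begin

text \<open>
  With \<open>q = 1 / a\<close>, Euler's entire function
  \<open>f z = (\<Prod>i. 1 - z * q ^ i)\<close> vanishes exactly at the points \<open>a ^ k\<close>, and its Taylor coefficients
  \<open>c j = (- 1) ^ j * q ^ (j * (j - 1) / 2) / ((1 - q) * \<dots> * (1 - q ^ j))\<close> are, up to a bounded factor,
  of the size that the hypothesis prescribes as a lower bound for \<open>p j\<close>. So
  \<open>h j = c j / p j\<close> is bounded, and \<open>(\<Sum>j. a ^ (k * j) * p j * h j) = f (a ^ k) = 0\<close>; dividing \<open>h\<close> by
  the supremum of its absolute values gives the perturbation. The zeros are obtained without the product,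
  from the functional equation \<open>f z = (1 - z) * f (q * z)\<close>: it gives \<open>f 1 = 0\<close> and then carries
  the zero from \<open>a ^ k\<close> to \<open>a ^ (k + 1)\<close> (lemmas \<open>euler_fun_eq\<close>, \<open>euler_fun_zero\<close>).

  A perturbation \<open>h\<close> yields a second solution of the moment problem by reweighting the underlying
  probability with the density \<open>1 + h X \<ge> 0\<close>: the added signed mass has vanishing moments,
  but changes the mass of every atom at which \<open>h\<close> and the atom's mass do not vanish
  (lemma \<open>perturbation_imp_moment_indeterminate\<close>).
\<close>

section \<open>Euler's entire function with zeros in geometric progression\<close>

definition euler_coeff :: "real \<Rightarrow> nat \<Rightarrow> real" where
  "euler_coeff q j = (\<Prod>i<j. - (q ^ i / (1 - q ^ Suc i)))"

lemma one_minus_power_Suc_pos: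
  fixes q :: real
  assumes "0 < q" "q < 1"
  shows "0 < 1 - q ^ Suc i"
  using power_Suc_less_one[of q i] assms by simp

lemma euler_coeff_nonzero:
  assumes "0 < q" "q < 1"
  shows "euler_coeff q j \<noteq> 0"
  using assms one_minus_power_Suc_pos[OF assms, THEN less_imp_neq]
  by (simp add: euler_coeff_def del: power_Suc)

lemma euler_coeff_rec:
  assumes "0 < q" "q < 1"
  shows "euler_coeff q (Suc j) * (1 - q ^ Suc j) = - (q ^ j * euler_coeff q j)"
  using one_minus_power_Suc_pos[OF assms, of j] by (simp add: euler_coeff_def del: power_Suc)

lemma summable_euler_coeff:
  fixes q z :: real
  assumes q: "0 < q" "q < 1"
  shows "summable (\<lambda>j. euler_coeff q j * z ^ j)"
proof -
  have "(\<lambda>j. \<bar>z\<bar> / (1 - q) * q ^ j) \<longlonglongrightarrow> \<bar>z\<bar> / (1 - q) * 0"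
    using q by (intro tendsto_intros LIMSEQ_realpow_zero) auto
  then have "\<forall>\<^sub>F j in sequentially. \<bar>z\<bar> / (1 - q) * q ^ j < 1 / 2"
    by (intro order_tendstoD) auto
  then obtain N where N: "\<And>j. j \<ge> N \<Longrightarrow> \<bar>z\<bar> / (1 - q) * q ^ j < 1 / 2"
    by (auto simp: eventually_sequentially)
  show ?thesis
  proof (rule summable_ratio_test[where c = "1 / 2" and N = N])
    fix j assume "j \<ge> N"
    have less: "q ^ Suc j \<le> q"
      using q by (simp add: mult_left_le power_le_one)
    have "norm (euler_coeff q (Suc j) * z ^ Suc j)
        = \<bar>z\<bar> * q ^ j / (1 - q ^ Suc j) * norm (euler_coeff q j * z ^ j)"
      using q one_minus_power_Suc_pos[OF q, of j]
      by (simp add: euler_coeff_def abs_mult power_abs abs_of_pos)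
    also have "\<bar>z\<bar> * q ^ j / (1 - q ^ Suc j) \<le> \<bar>z\<bar> * q ^ j / (1 - q)"
      using q less one_minus_power_Suc_pos[OF q, of j]
      by (intro divide_left_mono mult_pos_pos mult_nonneg_nonneg) auto
    also have "\<dots> \<le> 1 / 2"
      using N[OF \<open>j \<ge> N\<close>] by simp
    finally show "norm (euler_coeff q (Suc j) * z ^ Suc j) \<le> 1 / 2 * norm (euler_coeff q j * z ^ j)"
      by (simp add: mult_right_mono)
  qed simp
qed

definition euler_fun :: "real \<Rightarrow> real \<Rightarrow> real" where
  "euler_fun q z = (\<Sum>j. euler_coeff q j * z ^ j)"

text \<open>The recursion says that \<open>f z - f (q * z)\<close>, whose coefficients are \<open>c j * (1 - q ^ j)\<close>, equals
  \<open>- z * f (q * z)\<close> coefficient by coefficient, the coefficient at \<open>0\<close> being \<open>0\<close> on both sides.\<close>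

lemma euler_fun_eq:
  assumes q: "0 < q" "q < 1"
  shows "euler_fun q z = (1 - z) * euler_fun q (q * z)"
proof -
  let ?c = "euler_coeff q"
  have sums: "(\<lambda>j. ?c j * w ^ j) sums euler_fun q w" for w
    unfolding euler_fun_def using summable_euler_coeff[OF q] by (rule summable_sums)
  have "(\<lambda>j. ?c j * z ^ j - ?c j * (q * z) ^ j) sums (euler_fun q z - euler_fun q (q * z))"
    by (intro sums_diff sums)
  then have "(\<lambda>j. ?c (Suc j) * z ^ Suc j - ?c (Suc j) * (q * z) ^ Suc j)
      sums (euler_fun q z - euler_fun q (q * z))"
    by (subst sums_Suc_iff) simp
  moreover have "?c (Suc j) * z ^ Suc j - ?c (Suc j) * (q * z) ^ Suc j = - z * (?c j * (q * z) ^ j)" for j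
  proof -
    have "?c (Suc j) * z ^ Suc j - ?c (Suc j) * (q * z) ^ Suc j
        = (?c (Suc j) * (1 - q ^ Suc j)) * z ^ Suc j"
      by (simp add: power_mult_distrib algebra_simps)
    then show ?thesis
      by (simp only: euler_coeff_rec[OF q]) (simp add: power_mult_distrib)
  qed
  ultimately have "(\<lambda>j. - z * (?c j * (q * z) ^ j)) sums (euler_fun q z - euler_fun q (q * z))"
    by (simp only:)
  moreover have "(\<lambda>j. - z * (?c j * (q * z) ^ j)) sums (- z * euler_fun q (q * z))"
    by (intro sums_mult sums)
  ultimately have "euler_fun q z - euler_fun q (q * z) = - z * euler_fun q (q * z)"
    by (rule sums_unique2)
  then show ?thesis
    by (simp add: algebra_simps)
qed

lemma euler_fun_zero:
  assumes "0 < q" "q < 1"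
  shows "euler_fun q ((1 / q) ^ k) = 0"
proof (induction k)
  case 0
  show ?case
    using euler_fun_eq[OF assms, of 1] by simp
next
  case (Suc k)
  have "q * (1 / q) ^ Suc k = (1 / q) ^ k"
    using assms by simp
  then show ?case
    using euler_fun_eq[OF assms, of "(1 / q) ^ Suc k"] Suc by simp
qed

text \<open>The factors \<open>1 / (1 - q ^ i)\<close> have a bounded product because \<open>1 / (1 - x) \<le> exp (x / (1 - x))\<close>
  and \<open>(\<Sum>i. q ^ i)\<close> converges.\<close>

lemma euler_coeff_bound:
  assumes q: "0 < q" "q < 1"
  shows "\<bar>euler_coeff q j\<bar> \<le> exp (1 / (1 - q)\<^sup>2) * q powr (real j * (real j - 1) / 2)"
proof -
  note pos = one_minus_power_Suc_pos[OF q]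
  have factor: "1 / (1 - q ^ Suc i) \<le> exp (q ^ i / (1 - q))" for i
  proof -
    have le: "q ^ Suc i \<le> q" "q ^ Suc i \<le> q ^ i"
      using q by (simp_all add: mult_left_le mult_left_le_one_le power_le_one)
    have "1 / (1 - q ^ Suc i) = 1 + q ^ Suc i / (1 - q ^ Suc i)"
      using pos[of i] by (simp add: field_simps del: power_Suc)
    also have "\<dots> \<le> 1 + q ^ i / (1 - q)"
      using q le by (intro add_left_mono frac_le) auto
    also have "\<dots> \<le> exp (q ^ i / (1 - q))"
      by (rule exp_ge_add_one_self)
    finally show ?thesis .
  qed
  have "(\<Prod>i<j. 1 / (1 - q ^ Suc i)) \<le> (\<Prod>i<j. exp (q ^ i / (1 - q)))"
    using pos factor by (intro prod_mono) (auto intro: less_imp_le simp del: power_Suc)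
  also have "\<dots> = exp ((\<Sum>i<j. q ^ i) / (1 - q))"
    by (simp add: exp_sum sum_divide_distrib)
  also have "(\<Sum>i<j. q ^ i) \<le> 1 / (1 - q)"
    using q sum_le_suminf[of "\<lambda>i. q ^ i" "{..<j}"] by (simp add: summable_geometric suminf_geometric)
  finally have denom: "(\<Prod>i<j. 1 / (1 - q ^ Suc i)) \<le> exp (1 / (1 - q)\<^sup>2)"
    using q by (simp add: power2_eq_square divide_right_mono)
  have num: "(\<Prod>i<j. q ^ i) = q powr (real j * (real j - 1) / 2)"
  proof (induction j)
    case (Suc j)
    have "q powr (real j * (real j - 1) / 2) * q ^ j = q powr (real j * (real j - 1) / 2 + real j)"
      using q by (simp add: powr_add powr_realpow)
    also have "real j * (real j - 1) / 2 + real j = real (Suc j) * (real (Suc j) - 1) / 2"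
      by (simp add: field_simps)
    finally show ?case
      using Suc by simp
  qed (use q in simp)
  have "\<bar>euler_coeff q j\<bar> = (\<Prod>i<j. q ^ i * (1 / (1 - q ^ Suc i)))"
    unfolding euler_coeff_def abs_prod
    using q pos by (intro prod.cong) (auto simp: abs_mult abs_of_pos simp del: power_Suc)
  also have "\<dots> = (\<Prod>i<j. 1 / (1 - q ^ Suc i)) * q powr (real j * (real j - 1) / 2)"
    by (simp only: prod.distrib num mult.commute)
  also have "\<dots> \<le> exp (1 / (1 - q)\<^sup>2) * q powr (real j * (real j - 1) / 2)"
    by (intro mult_right_mono denom) simp
  finally show ?thesis .
qed

section \<open>Perturbations and moment indeterminacy\<close>

lemma (in prob_space) expectation_nat_sums:
  fixes X :: "'a \<Rightarrow> nat" and g :: "nat \<Rightarrow> real"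
  assumes [measurable]: "X \<in> measurable M (count_space UNIV)"
    and int: "integrable M (\<lambda>\<omega>. g (X \<omega>))"
  shows "(\<lambda>j. g j * prob {\<omega> \<in> space M. X \<omega> = j}) sums expectation (\<lambda>\<omega>. g (X \<omega>))"
proof -
  let ?p = "\<lambda>j. prob {\<omega> \<in> space M. X \<omega> = j}"
  let ?D = "distr M (count_space UNIV) X"
  have D: "?D = density (count_space UNIV) (\<lambda>j. ennreal (?p j))"
  proof (rule measure_eqI_countable[where A = UNIV])
    fix j
    have "emeasure ?D {j} = ennreal (?p j)"
      by (subst emeasure_distr) (auto simp: emeasure_eq_measure vimage_def Int_def conj_commute)
    also have "\<dots> = emeasure (density (count_space UNIV) (\<lambda>j. ennreal (?p j))) {j}"
      by (subst emeasure_density) (auto simp: nn_integral_count_space_indicator[symmetric])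
    finally show "emeasure ?D {j} = \<dots>" .
  qed auto
  have "integrable ?D g"
    using int by (subst integrable_distr_eq) auto
  then have "integrable (count_space UNIV) (\<lambda>j. ?p j * g j)"
    unfolding D by (subst (asm) integrable_density) auto
  then have "(\<lambda>j. ?p j * g j) sums (\<integral>j. ?p j * g j \<partial>count_space UNIV)"
    by (rule sums_integral_count_space_nat)
  also have "(\<integral>j. ?p j * g j \<partial>count_space UNIV) = (\<integral>j. g j \<partial>?D)"
    unfolding D by (subst integral_density) auto
  also have "\<dots> = expectation (\<lambda>\<omega>. g (X \<omega>))"
    by (subst integral_distr) auto
  finally show ?thesis
    by (simp add: mult.commute)
qed

text \<open>The second measure is the law of the same random variable \<open>x (X \<omega>)\<close> under the probability with
  density \<open>1 + h (X \<omega>)\<close>. Its moments exist because \<open>\<bar>h\<bar> \<le> 1\<close>, and its moment of order \<open>0\<close> being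
  unchanged says that it is again a probability.\<close>

lemma (in prob_space) perturbation_imp_moment_indeterminate:
  fixes X :: "'a \<Rightarrow> nat" and x h :: "nat \<Rightarrow> real"
  assumes X [measurable]: "X \<in> measurable M (count_space UNIV)"
    and pert: "perturbation x (\<lambda>y. prob {\<omega> \<in> space M. x (X \<omega>) = y}) h"
    and pos: "\<And>j. prob {\<omega> \<in> space M. X \<omega> = j} > 0"
    and moments: "\<And>k::nat. integrable M (\<lambda>\<omega>. x (X \<omega>) ^ k)"
  shows "moment_indeterminate (distr M borel (\<lambda>\<omega>. x (X \<omega>)))"
proof -
  let ?\<mu> = "distr M borel (\<lambda>\<omega>. x (X \<omega>))"
  let ?N = "density M (\<lambda>\<omega>. ennreal (1 + h (X \<omega>)))"
  let ?\<nu> = "distr ?N borel (\<lambda>\<omega>. x (X \<omega>))"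
  have inj: "inj x" and bdd: "bdd_above (range (\<lambda>j. \<bar>h j\<bar>))" and sup: "(SUP j. \<bar>h j\<bar>) = 1"
    using pert by (auto simp: perturbation_def discrete_pmf_def)
  have h_le: "\<bar>h j\<bar> \<le> 1" for j
    using cSUP_upper[OF UNIV_I bdd, of j] sup by simp
  then have h_ge: "0 \<le> 1 + h j" for j
    using abs_le_D2[OF h_le[of j]] by simp
  have int_h: "integrable M (\<lambda>\<omega>. x (X \<omega>) ^ k * h (X \<omega>))" for k
    by (rule Bochner_Integration.integrable_bound[OF moments[of k]])
      (auto simp: abs_mult h_le mult_left_le)
  have zero: "expectation (\<lambda>\<omega>. x (X \<omega>) ^ k * h (X \<omega>)) = 0" for k
  proof (rule sums_unique2)
    show "(\<lambda>j. x j ^ k * h j * prob {\<omega> \<in> space M. X \<omega> = j})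
        sums expectation (\<lambda>\<omega>. x (X \<omega>) ^ k * h (X \<omega>))"
      by (rule expectation_nat_sums[OF X int_h])
    show "(\<lambda>j. x j ^ k * h j * prob {\<omega> \<in> space M. X \<omega> = j}) sums 0"
      using pert inj by (simp add: perturbation_def inj_eq mult_ac)
  qed
  have int_N: "integrable M (\<lambda>\<omega>. (1 + h (X \<omega>)) * x (X \<omega>) ^ k)" for k
    using Bochner_Integration.integrable_add[OF moments[of k] int_h[of k]] by (simp add: algebra_simps)
  have int_\<nu>: "integrable ?\<nu> (\<lambda>y. y ^ k)" for k
    using int_N[of k] h_ge by (simp add: integrable_distr_eq integrable_density)
  have moment_\<nu>: "(\<integral>y. y ^ k \<partial>?\<nu>) = (\<integral>y. y ^ k \<partial>?\<mu>)" for k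
  proof -
    have "(\<integral>y. y ^ k \<partial>?\<nu>) = expectation (\<lambda>\<omega>. (1 + h (X \<omega>)) * x (X \<omega>) ^ k)"
      using h_ge by (simp add: integral_distr integral_density)
    also have "\<dots> = expectation (\<lambda>\<omega>. x (X \<omega>) ^ k) + expectation (\<lambda>\<omega>. x (X \<omega>) ^ k * h (X \<omega>))"
      using Bochner_Integration.integral_add[OF moments[of k] int_h[of k]] by (simp add: algebra_simps)
    finally show ?thesis
      by (simp add: zero integral_distr)
  qed
  have "prob_space ?N"
  proof
    have "emeasure ?N (space ?N) = (\<integral>\<^sup>+\<omega>. ennreal (1 + h (X \<omega>)) \<partial>M)"
      by (simp add: emeasure_density cong: nn_integral_cong)
    also have "\<dots> = ennreal (expectation (\<lambda>\<omega>. 1 + h (X \<omega>)))"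
      using int_N[of 0] h_ge by (intro nn_integral_eq_integral) auto
    also have "expectation (\<lambda>\<omega>. 1 + h (X \<omega>)) = 1"
      using Bochner_Integration.integral_add[OF moments[of 0] int_h[of 0]] zero[of 0]
      by (simp add: prob_space)
    finally show "emeasure ?N (space ?N) = 1"
      by simp
  qed
  then have prob_\<nu>: "prob_space ?\<nu>"
    by (rule prob_space.prob_space_distr) simp
  \<comment> \<open>The two laws are told apart by the mass of an atom \<open>x j\<close> with \<open>h j \<noteq> 0\<close>.\<close>
  have "\<exists>j. h j \<noteq> 0"
    using sup by (rule_tac ccontr) simp
  then obtain j where j: "h j \<noteq> 0" ..
  let ?A = "{\<omega> \<in> space M. X \<omega> = j}"
  have vimage: "(\<lambda>\<omega>. x (X \<omega>)) -` {x j} \<inter> space M = ?A"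
    using inj by (auto simp: inj_eq)
  have "emeasure ?\<mu> {x j} = ennreal (prob ?A)"
    by (simp add: emeasure_distr vimage emeasure_eq_measure)
  moreover have "emeasure ?\<nu> {x j} = ennreal ((1 + h j) * prob ?A)"
  proof -
    have "emeasure ?\<nu> {x j} = (\<integral>\<^sup>+\<omega>. ennreal (1 + h (X \<omega>)) * indicator ?A \<omega> \<partial>M)"
      by (simp add: emeasure_distr vimage emeasure_density)
    also have "\<dots> = (\<integral>\<^sup>+\<omega>. ennreal (1 + h j) * indicator ?A \<omega> \<partial>M)"
      by (intro nn_integral_cong) (auto simp: indicator_def)
    also have "\<dots> = ennreal ((1 + h j) * prob ?A)"
      using h_ge[of j] by (subst nn_integral_cmult_indicator) (auto simp: emeasure_eq_measure ennreal_mult)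
    finally show ?thesis .
  qed
  ultimately have "?\<nu> \<noteq> ?\<mu>"
    using pos[of j] h_ge[of j] j by (auto simp: ennreal_inj dest!: arg_cong[where f = "\<lambda>\<mu>. emeasure \<mu> {x j}"])
  moreover have "prob_space ?\<mu>"
    by (rule prob_space_distr) simp
  moreover have "integrable ?\<mu> (\<lambda>y. y ^ k)" for k
    using moments[of k] by (simp add: integrable_distr_eq)
  ultimately show ?thesis
    using prob_\<nu> int_\<nu> moment_\<nu>
    by (auto simp: moment_indeterminate_def prob_distribution_def finite_moments_def intro!: exI[of _ ?\<nu>])
qed

theorem theorem2p1:
  fixes M :: "'a measure" and X :: "'a \<Rightarrow> nat" and Y :: "'a \<Rightarrow> real"
    and a :: real and p :: "nat \<Rightarrow> real" and p\<^sub>Y :: "real \<Rightarrow> real"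
  assumes "prob_space M"
    and "X \<in> measurable M (count_space UNIV)"
    and "a > 1"
    and "\<And>j. p j = measure M {\<omega> \<in> space M. X \<omega> = j}"
    and "\<And>\<omega>. Y \<omega> = a ^ X \<omega>"
    and "\<And>y. p\<^sub>Y y = measure M {\<omega> \<in> space M. Y \<omega> = y}"
    and "\<exists>C>0. \<forall>j. p j \<ge> C * a powr (- (real j * (real j - 1) / 2))"
  shows "(\<exists>h. perturbation (\<lambda>j. a ^ j) p\<^sub>Y h) \<and>
    ((\<forall>k::nat. integrable M (\<lambda>\<omega>. Y \<omega> ^ k)) \<longrightarrow> moment_indeterminate (distr M borel Y))"
proof -
  interpret prob_space M by fact
  define q where "q = 1 / a"
  have q: "0 < q" "q < 1" and a_q: "1 / q = a"
    using \<open>a > 1\<close> by (simp_all add: q_def)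
  have Y: "Y = (\<lambda>\<omega>. a ^ X \<omega>)"
    using assms(5) by auto
  have pY: "p\<^sub>Y = (\<lambda>y. prob {\<omega> \<in> space M. a ^ X \<omega> = y})"
    using assms(6) by (auto simp: Y)
  have inj: "inj (\<lambda>j. a ^ j)"
    using \<open>a > 1\<close> by (auto intro: injI)
  have pY_p: "p\<^sub>Y (a ^ j) = p j" for j
    using \<open>a > 1\<close> by (simp add: pY assms(4))
  obtain C where "C > 0" and C: "\<And>j. p j \<ge> C * a powr (- (real j * (real j - 1) / 2))"
    using assms(7) by auto
  have p_pos: "p j > 0" for j
    using C[of j] \<open>C > 0\<close> \<open>a > 1\<close> by (auto intro: less_le_trans[rotated])
  define g where "g j = euler_coeff q j / p j" for j
  have bound: "\<bar>g j\<bar> \<le> exp (1 / (1 - q)\<^sup>2) / C" for j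
  proof -
    let ?w = "a powr (- (real j * (real j - 1) / 2))"
    have "?w = q powr (real j * (real j - 1) / 2)"
      using \<open>a > 1\<close> by (simp add: q_def powr_divide powr_minus_divide)
    then have "\<bar>euler_coeff q j\<bar> \<le> exp (1 / (1 - q)\<^sup>2) / C * (C * ?w)"
      using euler_coeff_bound[OF q, of j] \<open>C > 0\<close> by simp
    also have "\<dots> \<le> exp (1 / (1 - q)\<^sup>2) / C * p j"
      using C \<open>C > 0\<close> by (intro mult_left_mono) auto
    finally show ?thesis
      using p_pos[of j] by (simp add: g_def abs_divide divide_le_eq)
  qed
  define D where "D = (SUP j. \<bar>g j\<bar>)"
  have bdd: "bdd_above (range (\<lambda>j. \<bar>g j\<bar>))"
    by (rule bdd_aboveI2) (rule bound)
  have g_le: "\<bar>g j\<bar> \<le> D" for j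
    unfolding D_def by (rule cSUP_upper[OF UNIV_I bdd])
  have "D > 0"
    using g_le[of 0] p_pos[of 0] euler_coeff_nonzero[OF q, of 0] by (auto simp: g_def intro: less_le_trans[rotated])
  define h where "h j = g j / D" for j
  have h_le: "\<bar>h j\<bar> \<le> 1" for j
    using g_le[of j] \<open>D > 0\<close> by (simp add: h_def abs_divide)
  have bdd_h: "bdd_above (range (\<lambda>j. \<bar>h j\<bar>))"
    by (rule bdd_aboveI2) (rule h_le)
  have "(SUP j. \<bar>h j\<bar>) = 1"
  proof (rule antisym)
    show "(SUP j. \<bar>h j\<bar>) \<le> 1"
      using h_le by (intro cSUP_least) auto
    have "\<bar>g j\<bar> \<le> (SUP j. \<bar>h j\<bar>) * D" for j
      using cSUP_upper[OF UNIV_I bdd_h, of j] \<open>D > 0\<close> by (simp add: h_def abs_divide divide_le_eq)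
    then have "D \<le> (SUP j. \<bar>h j\<bar>) * D"
      by (subst D_def) (auto intro: cSUP_least)
    then show "1 \<le> (SUP j. \<bar>h j\<bar>)"
      using \<open>D > 0\<close> by simp
  qed
  moreover have "(\<lambda>j. (a ^ j) ^ k * p\<^sub>Y (a ^ j) * h j) sums 0" for k
  proof -
    have "(\<lambda>j. euler_coeff q j * (a ^ k) ^ j / D) sums (euler_fun q (a ^ k) / D)"
      unfolding euler_fun_def by (intro sums_divide summable_sums summable_euler_coeff q)
    moreover have "(a ^ j) ^ k * p\<^sub>Y (a ^ j) * h j = euler_coeff q j * (a ^ k) ^ j / D" for j
      using p_pos[of j] by (simp add: pY_p h_def g_def power_mult[symmetric] mult.commute)
    ultimately show ?thesis
      using euler_fun_zero[OF q, of k] by (simp add: a_q)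
  qed
  moreover have "discrete_pmf (\<lambda>j. a ^ j) p\<^sub>Y"
    unfolding discrete_pmf_def
  proof (intro conjI allI impI)
    show "inj (\<lambda>j. a ^ j)"
      by (rule inj)
    show "0 \<le> p\<^sub>Y y" for y
      by (simp add: pY)
    show "p\<^sub>Y y = 0" if "y \<notin> range (\<lambda>j. a ^ j)" for y
    proof -
      have "{\<omega> \<in> space M. a ^ X \<omega> = y} = {}"
        using that by auto
      then show ?thesis
        by (simp only: pY measure_empty)
    qed
    show "(\<lambda>j. p\<^sub>Y (a ^ j)) sums 1"
      using expectation_nat_sums[OF assms(2), of "\<lambda>_. 1"] by (simp add: pY_p assms(4) prob_space)
  qed
  ultimately have pert: "perturbation (\<lambda>j. a ^ j) p\<^sub>Y h"
    using bdd_h by (simp add: perturbation_def)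
  moreover have "moment_indeterminate (distr M borel Y)"
    if "\<forall>k::nat. integrable M (\<lambda>\<omega>. Y \<omega> ^ k)"
    unfolding Y
  proof (rule perturbation_imp_moment_indeterminate[OF assms(2)])
    show "perturbation (\<lambda>j. a ^ j) (\<lambda>y. prob {\<omega> \<in> space M. a ^ X \<omega> = y}) h"
      using pert by (simp add: pY)
    show "prob {\<omega> \<in> space M. X \<omega> = j} > 0" for j
      using p_pos[of j] by (simp add: assms(4))
    show "integrable M (\<lambda>\<omega>. (a ^ X \<omega>) ^ k)" for k
      using that by (simp add: Y)
  qed
  ultimately show ?thesis
    by blast
qed

end
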